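(* Let $f:\mathbb{R}\to\mathbb{R}$ be twice differentiable, $L$-smooth and $\mu$-strongly convex with $L,\mu>0$, and let $x^*$ be its minimizer. Let $0<\alpha<1$, $\beta\in\mathbb{R}$, $\gamma=\frac{1-\alpha}{2-\alpha}$, and set $$K_1=\tfrac{L+\mu}{2}(\beta-\gamma),\qquad K_2=\begin{cases}\tfrac{L-\mu}{2}(\beta+\gamma)&\text{if }\beta\ge0,\\ \tfrac{\mu-L}{2}(\beta-\gamma)&\text{if }\beta\le0.\end{cases}$$ Let $0<\phi<2$, $\epsilon>0$, and let $(\lambda_t)_{t\ge0}$ be real numbers with $1-K_1\lambda_t-K_2|\lambda_t|>\epsilon$ for all $t$. Let $x_0\in\mathbb{R}$ and define, for $t\ge0$, $$x_{t+1}=x_t-\eta_t\,{}^{C}\delta^{\alpha,\beta}_{c_t}f(x_t),\qquad \eta_t=\frac{(1-K_1\lambda_t-K_2|\lambda_t|)\phi}{(1-K_1\lambda_t+K_2|\lambda_t|)^2L},\qquad x_t-c_t=-\lambda_tf'(x_t).$$ Then for all $t\ge0$, $$|x_{t+1}-x^*|^2\le\left[1-(2-\phi)\phi\frac{\mu}{L}\left(\frac{1-K_1\lambda_t-K_2|\lambda_t|}{1-K_1\lambda_t+K_2|\lambda_t|}\right)^2\right]|x_t-x^*|^2 .$$ In particular, this rate is at best the same as that of gradient descent: the bracketed factor is at least $1-\frac{\mu}{L}$.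
   Context: $f:\mathbb{R}\to\mathbb{R}$ is $L$-smooth if $|f(y)-f(x)-f'(x)(y-x)|\le\frac L2|y-x|^2$ for all $x,y$, and $\mu$-strongly convex if $f(y)-f(x)-f'(x)(y-x)\ge\frac\mu2|y-x|^2$ for all $x,y$. For non-integer $\nu>0$, $n=\lceil\nu\rceil$ and $x\ne c$, the Caputo derivative is $${}^{C}D^{\nu}_{c}f(x)=\frac{(\operatorname{sgn}(x-c))^{n-1}}{\Gamma(n-\nu)}\int_c^x\frac{f^{(n)}(t)}{|x-t|^{\nu-n+1}}\,dt ,$$ with $\operatorname{sgn}$ the sign function, $\Gamma$ the gamma function, and $\int_c^x$ the oriented integral. For $\alpha\in(0,1)$, $\beta\in\mathbb{R}$, $x\neq c$, $${}^{C}\delta^{\alpha,\beta}_{c}f(x)=\frac{\Gamma(2-\alpha)|x-c|^{\alpha}}{x-c}\Big({}^{C}D^{\alpha}_{c}f(x)+\beta|x-c|\,{}^{C}D^{1+\alpha}_{c}f(x)\Big),$$ and for $c=x$ it is read as its limiting value ${}^{C}\delta^{\alpha,\beta}_{x}f(x)=f'(x)$. *)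

theory Defs
  imports "HOL-Analysis.Analysis"
begin

(* In the next two definitions deriv f denotes f' only where f is differentiable;
   they are meant for differentiable f. *)

definition L_smooth :: "real \<Rightarrow> (real \<Rightarrow> real) \<Rightarrow> bool" where
  "L_smooth L f \<longleftrightarrow>
     (\<forall>x y. \<bar>f y - f x - deriv f x * (y - x)\<bar> \<le> L / 2 * \<bar>y - x\<bar>\<^sup>2)"

definition strongly_convex :: "real \<Rightarrow> (real \<Rightarrow> real) \<Rightarrow> bool" where
  "strongly_convex \<mu> f \<longleftrightarrow>
     (\<forall>x y. f y - f x - deriv f x * (y - x) \<ge> \<mu> / 2 * \<bar>y - x\<bar>\<^sup>2)"

definition twice_differentiable :: "(real \<Rightarrow> real) \<Rightarrow> bool" where
  "twice_differentiable f \<longleftrightarrow>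
     (\<forall>x. f differentiable (at x)) \<and> (\<forall>x. deriv f differentiable (at x))"

(* Intended for non-integer nu > 0 and x \<noteq> c.  The interval Lebesgue integral is oriented:
   for x < c it is minus the integral over {x<..<c}.  The singular endpoint t = x,
   where the integrand has the conventional value 0, is a null set. *)

definition caputo :: "real \<Rightarrow> real \<Rightarrow> (real \<Rightarrow> real) \<Rightarrow> real \<Rightarrow> real" where
  "caputo \<nu> c f x =
     (let n = nat \<lceil>\<nu>\<rceil> in
        sgn (x - c) ^ (n - 1) / Gamma (real n - \<nu>) *
        (LBINT t=ereal c..ereal x.
           (deriv ^^ n) f t / \<bar>x - t\<bar> powr (\<nu> - real n + 1)))"

(* Intended for 0 < \<alpha> < 1; the value at x = c is the limit as c tends to x. *)

definition caputo_delta ::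
  "real \<Rightarrow> real \<Rightarrow> real \<Rightarrow> (real \<Rightarrow> real) \<Rightarrow> real \<Rightarrow> real" where
  "caputo_delta \<alpha> \<beta> c f x =
     (if x = c then deriv f x
      else Gamma (2 - \<alpha>) * \<bar>x - c\<bar> powr \<alpha> / (x - c) *
             (caputo \<alpha> c f x + \<beta> * \<bar>x - c\<bar> * caputo (1 + \<alpha>) c f x))"

end

theory Submission imports Defs begin

text \<open>
  The fractional descent direction is a multiple of the ordinary derivative, and the multiplier can
  be localised; the rate then comes from the usual analysis of gradient descent.

  Put \<open>s = x - c\<close> and substitute \<open>t = x - s u\<close>. Both Caputo derivatives become integrals over
  the unit interval against the kernel \<open>u\<^sup>-\<^sup>\<alpha>\<close>, and the powers of \<open>\<bar>s\<bar>\<close>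
  and the Gamma factors in the definition of the direction are exactly the ones that cancel, for
  either sign of \<open>s\<close>. An integration by parts removes the first derivative from the integrand
  (\<open>caputo_delta_integral_form\<close>):
  \<open>\<delta> = f'(x) + s \<integral> f''(x - s u) w(u) du\<close> with
  \<open>w(u) = \<beta> (1 - \<alpha>) u\<^sup>-\<^sup>\<alpha> - (1 - u\<^sup>1\<^sup>-\<^sup>\<alpha>)\<close>.
  Smoothness and strong convexity confine \<open>f''\<close> to \<open>[\<mu>, L]\<close>. Replacing \<open>f''\<close> by the
  midpoint \<open>(L + \<mu>) / 2\<close> gives \<open>K1\<close>, because \<open>w\<close> has integral \<open>\<beta> - \<gamma>\<close>;
  the deviation is at most \<open>(L - \<mu>) / 2\<close> times the integral of \<open>\<bar>w\<bar>\<close>, which is at most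
  \<open>\<bar>\<beta>\<bar> + \<gamma>\<close>, and this gives \<open>K2\<close> (\<open>caputo_delta_deviation\<close>).

  With \<open>s = - \<lambda> f'(x)\<close> the direction is therefore \<open>m f'(x)\<close>, where \<open>m\<close> lies between
  \<open>A = 1 - K1 \<lambda> - K2 \<bar>\<lambda>\<bar>\<close> and \<open>B = 1 - K1 \<lambda> + K2 \<bar>\<lambda>\<bar>\<close>. Also
  \<open>f'(x) = h (x - x\<^sup>*)\<close> with \<open>h \<in> [\<mu>, L]\<close>, so a step multiplies the error by \<open>1 - p\<close>
  with \<open>p = \<eta> m h\<close>. The step size is chosen so that \<open>p \<le> \<phi>\<close> and
  \<open>p \<ge> \<phi> (\<mu> / L) (A / B)\<^sup>2\<close>, which bounds \<open>(1 - p)\<^sup>2 = 1 - p (2 - p)\<close> by the claimed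
  factor (\<open>scaled_gradient_step_contracts\<close>). That factor is at least \<open>1 - \<mu> / L\<close> because
  \<open>(2 - \<phi>) \<phi> \<le> 1\<close> and \<open>A \<le> B\<close>.
\<close>

section \<open>Derivatives of smooth strongly convex functions\<close>

text \<open>Adding the defining inequality at \<open>(x, y)\<close> to the one at \<open>(y, x)\<close> cancels the values
  of \<open>f\<close> and leaves only the increment of the derivative.\<close>

lemma deriv_increment_lower:
  assumes "strongly_convex \<mu> f"
  shows "\<mu> * (y - x)\<^sup>2 \<le> (deriv f y - deriv f x) * (y - x)"
proof -
  have "\<mu> / 2 * (y - x)\<^sup>2 \<le> f y - f x - deriv f x * (y - x)"
    and "\<mu> / 2 * (x - y)\<^sup>2 \<le> f x - f y - deriv f y * (x - y)"
    using assms by (auto simp: strongly_convex_def)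
  then show ?thesis
    by (simp add: algebra_simps power2_eq_square)
qed

lemma deriv_increment_upper:
  assumes "L_smooth L f"
  shows "(deriv f y - deriv f x) * (y - x) \<le> L * (y - x)\<^sup>2"
proof -
  have "\<bar>f y - f x - deriv f x * (y - x)\<bar> \<le> L / 2 * (y - x)\<^sup>2"
    and "\<bar>f x - f y - deriv f y * (x - y)\<bar> \<le> L / 2 * (x - y)\<^sup>2"
    using assms by (auto simp: L_smooth_def)
  then show ?thesis
    unfolding abs_le_iff by (simp add: algebra_simps power2_eq_square)
qed

lemma derivative_bounds_from_increments:
  fixes g :: "real \<Rightarrow> real"
  assumes der: "(g has_real_derivative D) (at x)"
    and lower: "\<And>y. a * (y - x)\<^sup>2 \<le> (g y - g x) * (y - x)"
    and upper: "\<And>y. (g y - g x) * (y - x) \<le> b * (y - x)\<^sup>2"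
  shows "D \<in> {a..b}"
proof -
  have quot: "a \<le> (g y - g x) / (y - x) \<and> (g y - g x) / (y - x) \<le> b" if "y \<noteq> x" for y
  proof -
    have "(g y - g x) / (y - x) = (g y - g x) * (y - x) / (y - x)\<^sup>2"
      using that by (simp add: power2_eq_square)
    moreover have "(y - x)\<^sup>2 > 0"
      using that by simp
    ultimately show ?thesis
      using lower[of y] upper[of y] by (simp add: pos_le_divide_eq pos_divide_le_eq)
  qed
  have lim: "((\<lambda>y. (g y - g x) / (y - x)) \<longlongrightarrow> D) (at x)"
    using der by (simp add: has_field_derivative_iff)
  have "a \<le> D"
    by (rule tendsto_lowerbound[OF lim]) (auto simp: eventually_at_filter quot)
  moreover have "D \<le> b"
    by (rule tendsto_upperbound[OF lim]) (auto simp: eventually_at_filter quot)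
  ultimately show ?thesis by simp
qed

text \<open>A derivative need not be continuous, but it is the pointwise limit of the continuous
  difference quotients.\<close>

lemma borel_measurable_derivative:
  fixes g g' :: "real \<Rightarrow> real"
  assumes der: "\<And>x. (g has_real_derivative g' x) (at x)"
  shows "g' \<in> borel_measurable borel"
proof (rule borel_measurable_LIMSEQ_real)
  have cont: "continuous_on UNIV g"
    using der by (meson DERIV_continuous continuous_at_imp_continuous_on)
  show "(\<lambda>x. (g (x + inverse (real (Suc n))) - g x) / inverse (real (Suc n)))
      \<in> borel_measurable borel" for n
    by (intro borel_measurable_continuous_onI continuous_intros
        continuous_on_compose2[OF cont]) auto
  show "(\<lambda>n. (g (x + inverse (real (Suc n))) - g x) / inverse (real (Suc n))) \<longlonglongrightarrow> g' x" for x
  proof -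
    have "filterlim (\<lambda>n. inverse (real (Suc n))) (at 0) sequentially"
      unfolding filterlim_at using LIMSEQ_inverse_real_of_nat by auto
    then show ?thesis
      using der[of x] filterlim_compose unfolding DERIV_def by blast
  qed
qed

section \<open>Integrals over the unit interval\<close>

lemma unit_interval_powr:
  fixes a :: real
  assumes "a > -1"
  shows set_integrable_unit_powr: "set_integrable lborel {0<..<1} (\<lambda>u. u powr a)"
    and set_integral_unit_powr: "(LBINT u:{0<..<1}. u powr a) = 1 / (a + 1)"
proof -
  have hk: "((\<lambda>u. u powr a) has_integral 1 / (a + 1)) {0<..<1}"
    using has_integral_powr_from_0[of a 1] assms by (simp add: has_integral_Icc_iff_Ioo)
  then have "(\<lambda>u. u powr a) absolutely_integrable_on {0<..<1}"
    by (intro nonnegative_absolutely_integrable_1) (auto simp: integrable_on_def)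
  then show int: "set_integrable lborel {0<..<1} (\<lambda>u. u powr a)"
    unfolding set_integrable_def by (simp add: integrable_completion)
  show "(LBINT u:{0<..<1}. u powr a) = 1 / (a + 1)"
    using set_borel_integral_eq_integral(2)[OF int] hk by (simp add: integral_unique)
qed

lemma set_integrable_unit_one: "set_integrable lborel {0<..<1} (\<lambda>u::real. 1::real)"
  unfolding set_integrable_def by simp

lemma set_integrable_bounded_times:
  fixes q k :: "real \<Rightarrow> real"
  assumes q: "q \<in> borel_measurable borel" and bound: "\<And>u. u \<in> {0<..<1} \<Longrightarrow> \<bar>q u\<bar> \<le> M"
    and k: "set_integrable lborel {0<..<1} k" and k_meas: "k \<in> borel_measurable borel"
  shows "set_integrable lborel {0<..<1} (\<lambda>u. q u * k u)"
proof (rule set_integrable_bound)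
  show "set_integrable lborel {0<..<1} (\<lambda>u. M * k u)"
    using k by simp
  have [measurable]: "q \<in> borel_measurable borel" "k \<in> borel_measurable borel"
    by (fact q k_meas)+
  show "set_borel_measurable lborel {0<..<1} (\<lambda>u. q u * k u)"
    unfolding set_borel_measurable_def by measurable
  have "\<bar>q u * k u\<bar> \<le> \<bar>M * k u\<bar>" if "u \<in> {0<..<1}" for u
    unfolding abs_mult using bound[OF that] by (intro mult_right_mono) auto
  then show "AE u in lborel. u \<in> {0<..<1} \<longrightarrow> norm (q u * k u) \<le> norm (M * k u)"
    by simp
qed

text \<open>The orientation of the integral on the left becomes the sign of the factor \<open>x - c\<close>, which
  is what makes a case distinction on the position of \<open>c\<close> unnecessary afterwards.\<close>

lemma oriented_integral_unit_interval:
  fixes F :: "real \<Rightarrow> real"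
  assumes "x \<noteq> c"
  shows "(LBINT t=ereal c..ereal x. F t)
    = (x - c) * (LBINT u:{0<..<1}. F (x - (x - c) * u))"
proof -
  have arg: "x + - (x - c) * u = x - (x - c) * u" for u
    by (simp add: algebra_simps)
  show ?thesis
  proof (cases "c < x")
    case True
    have "x + - (x - c) * u \<in> {c<..<x} \<longleftrightarrow> u \<in> {0<..<1}" for u
    proof -
      have "(x - c) * u < x - c \<longleftrightarrow> u < 1" and "0 < (x - c) * u \<longleftrightarrow> 0 < u"
        using True mult_less_cancel_left_pos[of "x - c" u 1] by (simp_all add: zero_less_mult_iff)
      then show ?thesis unfolding arg by (smt (verit) greaterThanLessThan_iff)
    qed
    then have ind: "indicator {c<..<x} (x + - (x - c) * u) = (indicator {0<..<1} u :: real)" for u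
      unfolding indicator_def by presburger
    have "(LBINT t=ereal c..ereal x. F t) = (LINT t|lborel. indicator {c<..<x} t *\<^sub>R F t)"
      using True by (simp add: interval_lebesgue_integral_def set_lebesgue_integral_def)
    also have "\<dots> = \<bar>- (x - c)\<bar> *\<^sub>R (LINT u|lborel.
        indicator {c<..<x} (x + - (x - c) * u) *\<^sub>R F (x + - (x - c) * u))"
      by (rule lborel_integral_real_affine) (use assms in simp)
    finally show ?thesis
      unfolding ind unfolding arg using True by (simp add: set_lebesgue_integral_def)
  next
    case False
    then have less: "x < c" using assms by simp
    have "x + - (x - c) * u \<in> {x<..<c} \<longleftrightarrow> u \<in> {0<..<1}" for u
    proof -
      have "(c - x) * u < c - x \<longleftrightarrow> u < 1" and "0 < (c - x) * u \<longleftrightarrow> 0 < u"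
        using less mult_less_cancel_left_pos[of "c - x" u 1] by (simp_all add: zero_less_mult_iff)
      moreover have "x + - (x - c) * u = x + (c - x) * u" by (simp add: algebra_simps)
      ultimately show ?thesis by (smt (verit) greaterThanLessThan_iff)
    qed
    then have ind: "indicator {x<..<c} (x + - (x - c) * u) = (indicator {0<..<1} u :: real)" for u
      unfolding indicator_def by presburger
    have "(LBINT t=ereal c..ereal x. F t) = - (LINT t|lborel. indicator {x<..<c} t *\<^sub>R F t)"
      using less by (simp add: interval_lebesgue_integral_def set_lebesgue_integral_def)
    also have "(LINT t|lborel. indicator {x<..<c} t *\<^sub>R F t) = \<bar>- (x - c)\<bar> *\<^sub>R (LINT u|lborel.
        indicator {x<..<c} (x + - (x - c) * u) *\<^sub>R F (x + - (x - c) * u))"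
      by (rule lborel_integral_real_affine) (use assms in simp)
    finally show ?thesis
      unfolding ind unfolding arg using less
      by (simp add: set_lebesgue_integral_def flip: mult_minus_left)
  qed
qed

text \<open>Integration by parts with the primitive \<open>u\<^sup>1\<^sup>-\<^sup>\<alpha> - 1\<close> of
  \<open>(1 - \<alpha>) u\<^sup>-\<^sup>\<alpha>\<close>: this choice of the constant makes the boundary term at \<open>1\<close> vanish and
  leaves \<open>G 0\<close> from the singular endpoint.\<close>

lemma singular_kernel_by_parts:
  fixes G G' :: "real \<Rightarrow> real"
  assumes der: "\<And>u. (G has_real_derivative G' u) (at u)"
    and bound: "\<And>u. \<bar>G' u\<bar> \<le> M"
    and \<alpha>: "0 < \<alpha>" "\<alpha> < 1"
  shows "(1 - \<alpha>) * (LBINT u:{0<..<1}. G u * u powr - \<alpha>)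
    = G 0 + (LBINT u:{0<..<1}. G' u * (1 - u powr (1 - \<alpha>)))"
proof -
  let ?I = "{0<..<1::real}"
  have G_cont: "continuous_on S G" for S
    using der by (meson DERIV_continuous continuous_at_imp_continuous_on)
  obtain N where N: "\<forall>u\<in>{0..1}. \<bar>G u\<bar> \<le> N"
    using compact_imp_bounded[OF compact_continuous_image[OF G_cont compact_Icc], of 0 1]
    by (auto simp: bounded_iff)
  have G_int: "set_integrable lborel ?I (\<lambda>u. G u * u powr - \<alpha>)"
    using N \<alpha> by (intro set_integrable_bounded_times[of _ N] set_integrable_unit_powr
        borel_measurable_continuous_onI[OF G_cont]) auto
  have G'_int: "set_integrable lborel ?I (\<lambda>u. G' u * (1 - u powr (1 - \<alpha>)))"
    using \<alpha> by (intro set_integrable_bounded_times[of _ M] bound borel_measurable_derivative[OF der]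
        set_integral_diff(1) set_integrable_unit_one set_integrable_unit_powr) auto
  let ?H = "\<lambda>u. G u * (u powr (1 - \<alpha>) - 1)"
  let ?h = "\<lambda>u. (1 - \<alpha>) * (G u * u powr - \<alpha>) - G' u * (1 - u powr (1 - \<alpha>))"
  have "(?h has_integral (?H 1 - ?H 0)) {0..1}"
  proof (rule fundamental_theorem_of_calculus_interior)
    show "continuous_on {0..1} ?H"
      using \<alpha> by (intro continuous_intros G_cont continuous_on_powr') auto
    fix u :: real assume "u \<in> {0<..<1}"
    then have "(?H has_real_derivative ?h u) (at u)"
      by (auto intro!: derivative_eq_intros der simp: algebra_simps)
    then show "(?H has_vector_derivative ?h u) (at u)"
      by (simp add: has_real_derivative_iff_has_vector_derivative)
  qed simp
  then have "integral ?I ?h = G 0"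
    using \<alpha> by (simp add: has_integral_Icc_iff_Ioo integral_unique)
  moreover have "set_integrable lborel ?I ?h"
    using G_int G'_int by (intro set_integral_diff(1)) auto
  ultimately have "(LBINT u:?I. ?h u) = G 0"
    by (simp add: set_borel_integral_eq_integral(2))
  then show ?thesis
    using G_int G'_int by (simp add: set_integral_diff(2))
qed

section \<open>The fractional direction as a perturbed gradient\<close>

text \<open>For both orders the kernel exponent is \<open>\<alpha>\<close>. The orders differ in the factor in front: the
  oriented integral contributes \<open>x - c\<close>, which the sign in the definition turns into
  \<open>\<bar>x - c\<bar>\<close> for the second one.\<close>

lemma caputo_order_below_one:
  assumes "0 < \<alpha>" "\<alpha> < 1" "x \<noteq> c"
  shows "caputo \<alpha> c f x = (x - c) / (Gamma (1 - \<alpha>) * \<bar>x - c\<bar> powr \<alpha>)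
    * (LBINT u:{0<..<1}. deriv f (x - (x - c) * u) * u powr - \<alpha>)"
proof -
  have ceil: "\<lceil>\<alpha>\<rceil> = 1" using assms by (simp add: ceiling_eq_iff)
  have "(LBINT t=ereal c..ereal x. deriv f t / \<bar>x - t\<bar> powr \<alpha>)
    = (x - c) * (LBINT u:{0<..<1}. deriv f (x - (x - c) * u) / \<bar>(x - c) * u\<bar> powr \<alpha>)"
    using oriented_integral_unit_interval[OF assms(3), of "\<lambda>t. deriv f t / \<bar>x - t\<bar> powr \<alpha>"]
    by simp
  also have "(LBINT u:{0<..<1}. deriv f (x - (x - c) * u) / \<bar>(x - c) * u\<bar> powr \<alpha>)
    = (LBINT u:{0<..<1}. (deriv f (x - (x - c) * u) * u powr - \<alpha>) / \<bar>x - c\<bar> powr \<alpha>)"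
    by (intro set_lebesgue_integral_cong)
      (auto simp: abs_mult powr_mult powr_minus divide_simps)
  finally show ?thesis
    unfolding caputo_def Let_def ceil by simp
qed

lemma caputo_order_above_one:
  assumes "0 < \<alpha>" "\<alpha> < 1" "x \<noteq> c"
  shows "caputo (1 + \<alpha>) c f x = \<bar>x - c\<bar> / (Gamma (1 - \<alpha>) * \<bar>x - c\<bar> powr \<alpha>)
    * (LBINT u:{0<..<1}. deriv (deriv f) (x - (x - c) * u) * u powr - \<alpha>)"
proof -
  have ceil: "\<lceil>1 + \<alpha>\<rceil> = 2" using assms by (simp add: ceiling_eq_iff)
  have "(LBINT t=ereal c..ereal x. deriv (deriv f) t / \<bar>x - t\<bar> powr \<alpha>)
    = (x - c) * (LBINT u:{0<..<1}. deriv (deriv f) (x - (x - c) * u) / \<bar>(x - c) * u\<bar> powr \<alpha>)"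
    using oriented_integral_unit_interval[OF assms(3), of "\<lambda>t. deriv (deriv f) t / \<bar>x - t\<bar> powr \<alpha>"]
    by simp
  also have "(LBINT u:{0<..<1}. deriv (deriv f) (x - (x - c) * u) / \<bar>(x - c) * u\<bar> powr \<alpha>)
    = (LBINT u:{0<..<1}. (deriv (deriv f) (x - (x - c) * u) * u powr - \<alpha>) / \<bar>x - c\<bar> powr \<alpha>)"
    by (intro set_lebesgue_integral_cong)
      (auto simp: abs_mult powr_mult powr_minus divide_simps)
  finally show ?thesis
    unfolding caputo_def Let_def ceil
    by (simp add: numeral_2_eq_2 sgn_mult_abs abs_sgn mult_ac)
qed

text \<open>The density of the second derivative in the fractional direction. The summand with \<open>\<beta>\<close> is
  the kernel of the order \<open>1 + \<alpha>\<close> and has integral \<open>\<beta>\<close>; the other one is nonpositive on the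
  unit interval, has integral \<open>- (1 - \<alpha>) / (2 - \<alpha>)\<close> and arises by parts from the order \<open>\<alpha>\<close>.\<close>

definition direction_weight :: "real \<Rightarrow> real \<Rightarrow> real \<Rightarrow> real" where
  "direction_weight \<alpha> \<beta> u = \<beta> * ((1 - \<alpha>) * u powr - \<alpha>) + (u powr (1 - \<alpha>) - 1)"

text \<open>Only the second derivative is controlled along the segment from \<open>c\<close> to \<open>x\<close>, and this form
  uses the first derivative at \<open>x\<close> alone. The integrals exist because the second derivative is measurable and
  bounded and the weight is integrable.\<close>

lemma caputo_delta_integral_form:
  fixes f :: "real \<Rightarrow> real"
  assumes der: "\<And>t. (deriv f has_real_derivative deriv (deriv f) t) (at t)"
    and bound: "\<And>t. \<bar>deriv (deriv f) t\<bar> \<le> M"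
    and \<alpha>: "0 < \<alpha>" "\<alpha> < 1" and "x \<noteq> c"
  shows "caputo_delta \<alpha> \<beta> c f x = deriv f x + (x - c) *
    (LBINT u:{0<..<1}. deriv (deriv f) (x - (x - c) * u) * direction_weight \<alpha> \<beta> u)"
proof -
  let ?I = "{0<..<1::real}"
  define s where "s = x - c"
  have s: "s \<noteq> 0" using \<open>x \<noteq> c\<close> by (simp add: s_def)
  define q where "q u = deriv (deriv f) (x - s * u)" for u
  have q_bound: "\<bar>q u\<bar> \<le> M" for u
    using bound by (simp add: q_def)
  have q_meas: "q \<in> borel_measurable borel"
  proof -
    have [measurable]: "deriv (deriv f) \<in> borel_measurable borel"
      by (rule borel_measurable_derivative[OF der])
    show ?thesis unfolding q_def by measurable
  qed
  define J1 where "J1 = (LBINT u:?I. deriv f (x - s * u) * u powr - \<alpha>)"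
  define J2 where "J2 = (LBINT u:?I. q u * u powr - \<alpha>)"
  define J3 where "J3 = (LBINT u:?I. q u * (1 - u powr (1 - \<alpha>)))"
  have parts: "(1 - \<alpha>) * J1 = deriv f x - s * J3"
  proof -
    have chain: "((\<lambda>u. deriv f (x - s * u)) has_real_derivative - s * q u) (at u)" for u
      unfolding q_def
      by (rule DERIV_cong[OF DERIV_chain2[OF der]]) (auto intro!: derivative_eq_intros)
    have "(1 - \<alpha>) * J1 = deriv f x + (LBINT u:?I. (- s * q u) * (1 - u powr (1 - \<alpha>)))"
      unfolding J1_def using singular_kernel_by_parts[OF chain, of "\<bar>s\<bar> * M" \<alpha>] \<alpha> q_bound
      by (simp add: abs_mult mult_left_mono)
    also have "(LBINT u:?I. (- s * q u) * (1 - u powr (1 - \<alpha>))) = - s * J3"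
      unfolding J3_def by (simp only: mult.assoc set_integral_mult_right)
    finally show ?thesis by simp
  qed
  have J2_int: "set_integrable lborel ?I (\<lambda>u. q u * u powr - \<alpha>)"
    using \<alpha> q_bound q_meas by (intro set_integrable_bounded_times[of _ M] set_integrable_unit_powr) auto
  have J3_int: "set_integrable lborel ?I (\<lambda>u. q u * (1 - u powr (1 - \<alpha>)))"
    using \<alpha> q_bound q_meas
    by (intro set_integrable_bounded_times[of _ M] set_integral_diff(1) set_integrable_unit_powr
        set_integrable_unit_one) auto
  have "(LBINT u:?I. q u * direction_weight \<alpha> \<beta> u)
    = (LBINT u:?I. (\<beta> * (1 - \<alpha>)) * (q u * u powr - \<alpha>) - q u * (1 - u powr (1 - \<alpha>)))"
    by (simp add: direction_weight_def algebra_simps)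
  also have "\<dots> = \<beta> * (1 - \<alpha>) * J2 - J3"
    unfolding J2_def J3_def using J2_int J3_int
    by (subst set_integral_diff(2)) (auto simp: set_integral_mult_right)
  finally have weight: "(LBINT u:?I. q u * direction_weight \<alpha> \<beta> u) = \<beta> * (1 - \<alpha>) * J2 - J3" .
  have Gamma: "Gamma (2 - \<alpha>) = (1 - \<alpha>) * Gamma (1 - \<alpha>)"
  proof -
    have "1 - \<alpha> \<notin> \<int>\<^sub>\<le>\<^sub>0" using \<alpha> nonpos_Ints_nonpos by force
    then show ?thesis using Gamma_plus1[of "1 - \<alpha>"] by simp
  qed
  have Gamma_pos: "Gamma (1 - \<alpha>) > 0" using \<alpha> by (simp add: Gamma_real_pos)
  have "caputo_delta \<alpha> \<beta> c f x = (1 - \<alpha>) * Gamma (1 - \<alpha>) * \<bar>s\<bar> powr \<alpha> / s *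
      (s / (Gamma (1 - \<alpha>) * \<bar>s\<bar> powr \<alpha>) * J1
        + \<beta> * \<bar>s\<bar> * (\<bar>s\<bar> / (Gamma (1 - \<alpha>) * \<bar>s\<bar> powr \<alpha>) * J2))"
    unfolding J1_def J2_def q_def s_def caputo_delta_def
      caputo_order_below_one[OF \<alpha> \<open>x \<noteq> c\<close>] caputo_order_above_one[OF \<alpha> \<open>x \<noteq> c\<close>]
    using \<open>x \<noteq> c\<close> by (simp add: Gamma)
  also have "\<dots> = (1 - \<alpha>) * J1 + \<beta> * (1 - \<alpha>) * (\<bar>s\<bar> * \<bar>s\<bar> / s) * J2"
    using s Gamma_pos by (simp add: field_simps)
  also have "\<bar>s\<bar> * \<bar>s\<bar> / s = s"
    using s by simp
  also have "(1 - \<alpha>) * J1 + \<beta> * (1 - \<alpha>) * s * J2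
      = deriv f x + s * (LBINT u:?I. q u * direction_weight \<alpha> \<beta> u)"
    unfolding weight parts by (simp add: algebra_simps)
  finally show ?thesis
    unfolding q_def s_def .
qed

text \<open>The weight has mean \<open>\<beta> - \<gamma>\<close> and absolute mean at most \<open>\<bar>\<beta>\<bar> + \<gamma>\<close>, so the centre of
  the range of \<open>q\<close> contributes the first and its radius at most the second.\<close>

lemma direction_weight_average:
  fixes q :: "real \<Rightarrow> real"
  assumes q_meas: "q \<in> borel_measurable borel" and q_range: "\<And>u. q u \<in> {\<mu>..L}"
    and \<alpha>: "0 < \<alpha>" "\<alpha> < 1" and \<gamma>: "\<gamma> = (1 - \<alpha>) / (2 - \<alpha>)"
  shows "\<bar>(LBINT u:{0<..<1}. q u * direction_weight \<alpha> \<beta> u) - (L + \<mu>) / 2 * (\<beta> - \<gamma>)\<bar>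
    \<le> (L - \<mu>) / 2 * (\<bar>\<beta>\<bar> + \<gamma>)"
proof -
  let ?I = "{0<..<1::real}" and ?w = "direction_weight \<alpha> \<beta>"
  let ?W = "\<lambda>u::real. \<bar>\<beta>\<bar> * ((1 - \<alpha>) * u powr - \<alpha>) + (1 - u powr (1 - \<alpha>))"
  let ?m = "(L + \<mu>) / 2"
  have sing: "set_integrable lborel ?I (\<lambda>u. (1 - \<alpha>) * u powr - \<alpha>)"
    "(LBINT u:?I. (1 - \<alpha>) * u powr - \<alpha>) = 1"
    using \<alpha> by (simp_all add: set_integrable_unit_powr set_integral_unit_powr)
  have rest: "set_integrable lborel ?I (\<lambda>u. 1 - u powr (1 - \<alpha>))"
    "(LBINT u:?I. 1 - u powr (1 - \<alpha>)) = \<gamma>"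
  proof -
    have one: "(LBINT u:?I. (1::real)) = 1" by (simp add: set_lebesgue_integral_def)
    have p: "set_integrable lborel ?I (\<lambda>u. u powr (1 - \<alpha>))"
      using \<alpha> by (simp add: set_integrable_unit_powr)
    show "set_integrable lborel ?I (\<lambda>u. 1 - u powr (1 - \<alpha>))"
      by (intro set_integral_diff(1) set_integrable_unit_one p)
    show "(LBINT u:?I. 1 - u powr (1 - \<alpha>)) = \<gamma>"
      using \<alpha> \<gamma> by (simp add: set_integral_diff(2)[OF set_integrable_unit_one p] one
          set_integral_unit_powr field_simps)
  qed
  have sing_mult: "set_integrable lborel ?I (\<lambda>u. b * ((1 - \<alpha>) * u powr - \<alpha>))" for b
    by (intro set_integrable_mult_right sing(1))
  have w_eq: "?w = (\<lambda>u. \<beta> * ((1 - \<alpha>) * u powr - \<alpha>) - (1 - u powr (1 - \<alpha>)))"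
    by (auto simp: direction_weight_def)
  have w_int: "set_integrable lborel ?I ?w"
    unfolding w_eq by (intro set_integral_diff(1) sing_mult rest(1))
  have w_val: "(LBINT u:?I. ?w u) = \<beta> - \<gamma>"
    unfolding w_eq using sing_mult rest sing by (simp only: set_integral_diff(2) set_integral_mult_right)
  have W_int: "set_integrable lborel ?I ?W"
    by (intro set_integral_add(1) sing_mult rest(1))
  have W_val: "(LBINT u:?I. ?W u) = \<bar>\<beta>\<bar> + \<gamma>"
    using sing_mult rest sing by (simp only: set_integral_add(2) set_integral_mult_right)
  have w_le: "\<bar>?w u\<bar> \<le> ?W u" if "u \<in> ?I" for u
  proof -
    have "u powr (1 - \<alpha>) \<le> 1" using that \<alpha> by (intro powr_le1) auto
    then have "\<bar>u powr (1 - \<alpha>) - 1\<bar> = 1 - u powr (1 - \<alpha>)" by simp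
    moreover have "\<bar>\<beta> * ((1 - \<alpha>) * u powr - \<alpha>)\<bar> = \<bar>\<beta>\<bar> * ((1 - \<alpha>) * u powr - \<alpha>)"
      using \<alpha> by (simp add: abs_mult)
    ultimately show ?thesis
      unfolding direction_weight_def by (metis abs_triangle_ineq)
  qed
  have w_meas: "?w \<in> borel_measurable borel"
    unfolding direction_weight_def by measurable
  have dev_le: "\<bar>q u - ?m\<bar> \<le> (L - \<mu>) / 2" for u
    using q_range[of u] by (auto simp: abs_le_iff field_simps)
  have dev_int: "set_integrable lborel ?I (\<lambda>u. (q u - ?m) * ?w u)"
    using q_meas dev_le by (intro set_integrable_bounded_times[of _ "(L - \<mu>) / 2"] w_int w_meas) auto
  have "(LBINT u:?I. q u * ?w u) = (LBINT u:?I. (q u - ?m) * ?w u + ?m * ?w u)"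
    by (simp add: algebra_simps)
  also have "\<dots> = (LBINT u:?I. (q u - ?m) * ?w u) + ?m * (\<beta> - \<gamma>)"
    by (subst set_integral_add(2)) (use dev_int w_int w_val in \<open>auto simp del: times_divide_eq_left\<close>)
  finally have "\<bar>(LBINT u:?I. q u * ?w u) - ?m * (\<beta> - \<gamma>)\<bar> = \<bar>LBINT u:?I. (q u - ?m) * ?w u\<bar>"
    by simp
  also have "\<dots> \<le> (LBINT u:?I. \<bar>(q u - ?m) * ?w u\<bar>)"
    using set_integral_norm_bound[OF dev_int] by simp
  also have "\<dots> \<le> (LBINT u:?I. (L - \<mu>) / 2 * ?W u)"
  proof (rule set_integral_mono)
    show "set_integrable lborel ?I (\<lambda>u. \<bar>(q u - ?m) * ?w u\<bar>)"
      by (rule set_integrable_abs[OF dev_int])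
    show "set_integrable lborel ?I (\<lambda>u. (L - \<mu>) / 2 * ?W u)"
      by (intro set_integrable_mult_right W_int)
    show "\<bar>(q u - ?m) * ?w u\<bar> \<le> (L - \<mu>) / 2 * ?W u" if "u \<in> ?I" for u
      unfolding abs_mult
      by (intro mult_mono dev_le w_le that order_trans[OF abs_ge_zero dev_le]) auto
  qed
  also have "\<dots> = (L - \<mu>) / 2 * (\<bar>\<beta>\<bar> + \<gamma>)"
    by (simp only: set_integral_mult_right W_val)
  finally show ?thesis .
qed

text \<open>The direction at \<open>x\<close> is affine in \<open>x - c\<close> up to an error with the same scaling. For a quadratic
  \<open>f\<close>, where \<open>L = \<mu>\<close> is possible, the error vanishes.\<close>

lemma caputo_delta_deviation:
  fixes f :: "real \<Rightarrow> real"
  assumes der: "\<And>t. (deriv f has_real_derivative deriv (deriv f) t) (at t)"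
    and range: "\<And>t. deriv (deriv f) t \<in> {\<mu>..L}"
    and \<alpha>: "0 < \<alpha>" "\<alpha> < 1" and \<gamma>: "\<gamma> = (1 - \<alpha>) / (2 - \<alpha>)"
  shows "\<bar>caputo_delta \<alpha> \<beta> c f x - deriv f x - (L + \<mu>) / 2 * (\<beta> - \<gamma>) * (x - c)\<bar>
    \<le> (L - \<mu>) / 2 * (\<bar>\<beta>\<bar> + \<gamma>) * \<bar>x - c\<bar>"
proof (cases "x = c")
  case True
  then show ?thesis by (simp add: caputo_delta_def)
next
  case False
  define q where "q u = deriv (deriv f) (x - (x - c) * u)" for u
  have [measurable]: "deriv (deriv f) \<in> borel_measurable borel"
    by (rule borel_measurable_derivative[OF der])
  have q_meas: "q \<in> borel_measurable borel"
    unfolding q_def by measurable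
  have bound: "\<bar>deriv (deriv f) t\<bar> \<le> \<bar>\<mu>\<bar> + \<bar>L\<bar>" for t
    using range[of t] by auto
  let ?J = "LBINT u:{0<..<1}. q u * direction_weight \<alpha> \<beta> u"
  have "caputo_delta \<alpha> \<beta> c f x = deriv f x + (x - c) * ?J"
    unfolding q_def by (rule caputo_delta_integral_form[OF der bound \<alpha> False])
  then have "\<bar>caputo_delta \<alpha> \<beta> c f x - deriv f x - (L + \<mu>) / 2 * (\<beta> - \<gamma>) * (x - c)\<bar>
      = \<bar>(?J - (L + \<mu>) / 2 * (\<beta> - \<gamma>)) * (x - c)\<bar>"
    by (simp add: algebra_simps)
  also have "\<dots> = \<bar>?J - (L + \<mu>) / 2 * (\<beta> - \<gamma>)\<bar> * \<bar>x - c\<bar>"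
    by (rule abs_mult)
  also have "\<dots> \<le> (L - \<mu>) / 2 * (\<bar>\<beta>\<bar> + \<gamma>) * \<bar>x - c\<bar>"
    using direction_weight_average[OF q_meas _ \<alpha> \<gamma>] range
    by (intro mult_right_mono) (auto simp: q_def)
  finally show ?thesis .
qed

section \<open>Contraction of one step\<close>

text \<open>The step multiplies the error \<open>d\<close> by \<open>1 - p\<close>, where \<open>p\<close> is the product of the step size,
  the multiplier \<open>m\<close> of the derivative and the slope \<open>h\<close>. The largest multiplier and slope, \<open>B\<close> and
  \<open>L\<close>, give \<open>p \<le> \<phi> A / B \<le> \<phi>\<close>; the smallest ones, \<open>A\<close> and \<open>\<mu>\<close>, give
  \<open>p \<ge> \<phi> (A / B)\<^sup>2 \<mu> / L\<close>. Then \<open>1 - (1 - p)\<^sup>2 = p (2 - p)\<close>, and each factor is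
  bounded below separately.\<close>

lemma scaled_gradient_step_contracts:
  fixes A B L \<mu> \<phi> m h d :: real
  assumes A: "0 < A" and \<mu>: "0 < \<mu>" and \<phi>: "0 < \<phi>" "\<phi> < 2"
    and m: "A \<le> m" "m \<le> B" and h: "\<mu> \<le> h" "h \<le> L"
  shows "(d - A * \<phi> / (B\<^sup>2 * L) * (m * (h * d)))\<^sup>2
    \<le> (1 - (2 - \<phi>) * \<phi> * (\<mu> / L) * (A / B)\<^sup>2) * d\<^sup>2"
proof -
  define p where "p = A * \<phi> / (B\<^sup>2 * L) * (m * h)"
  define r where "r = (\<mu> / L) * (A / B)\<^sup>2"
  have B: "0 < B" and L: "0 < L" using A \<mu> m h by linarith+
  have "A * \<phi> / (B\<^sup>2 * L) * (A * \<mu>) \<le> p"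
    unfolding p_def using A B L \<mu> \<phi> m h by (intro mult_left_mono mult_mono) auto
  moreover have "A * \<phi> / (B\<^sup>2 * L) * (A * \<mu>) = \<phi> * r"
    unfolding r_def by (simp add: power2_eq_square mult_ac)
  ultimately have p_lower: "\<phi> * r \<le> p" by simp
  have "A * (m * h) \<le> B * (B * L)"
    using A B L \<mu> m h by (intro mult_mono) auto
  then have "A * \<phi> * (m * h) \<le> \<phi> * (B\<^sup>2 * L)"
    using mult_left_mono[of _ _ \<phi>] \<phi> by (simp add: power2_eq_square mult_ac)
  then have p_upper: "p \<le> \<phi>"
    unfolding p_def using B L by (simp add: pos_divide_le_eq)
  have r_nonneg: "0 \<le> r"
    unfolding r_def using \<mu> L by simp
  have p_nonneg: "0 \<le> p"
    using order_trans[OF mult_nonneg_nonneg p_lower] \<phi> r_nonneg by simp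
  have "\<phi> * r * (2 - \<phi>) \<le> p * (2 - p)"
    using p_lower p_upper p_nonneg \<phi> by (intro mult_mono) auto
  then have "(1 - p)\<^sup>2 \<le> 1 - (2 - \<phi>) * \<phi> * r"
    by (simp add: power2_eq_square algebra_simps)
  then have "(1 - p)\<^sup>2 * d\<^sup>2 \<le> (1 - (2 - \<phi>) * \<phi> * r) * d\<^sup>2"
    by (intro mult_right_mono) auto
  moreover have "(d - A * \<phi> / (B\<^sup>2 * L) * (m * (h * d)))\<^sup>2 = (1 - p)\<^sup>2 * d\<^sup>2"
    unfolding p_def power_mult_distrib[symmetric] by (simp add: algebra_simps)
  ultimately show ?thesis
    unfolding r_def by (simp add: mult.assoc)
qed

text \<open>The best case is \<open>\<phi> = 1\<close> and \<open>A = B\<close>, where the step is exactly the gradient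
  step of size \<open>1 / L\<close>.\<close>

lemma contraction_factor_ge_gradient_descent:
  fixes A B L \<mu> \<phi> :: real
  assumes "0 < A" "A \<le> B" "0 < \<mu>" "0 < L"
  shows "1 - \<mu> / L \<le> 1 - (2 - \<phi>) * \<phi> * (\<mu> / L) * (A / B)\<^sup>2"
proof -
  have "(2 - \<phi>) * \<phi> \<le> 1"
    using zero_le_power2[of "\<phi> - 1"] by (simp add: power2_eq_square algebra_simps)
  moreover have "(A / B)\<^sup>2 \<le> 1"
    using assms by (intro power_le_one) auto
  moreover have "0 \<le> \<mu> / L" using assms by simp
  ultimately have "(2 - \<phi>) * \<phi> * (A / B)\<^sup>2 * (\<mu> / L) \<le> 1 * 1 * (\<mu> / L)"
    by (intro mult_right_mono order_trans[OF mult_right_mono[of "(2 - \<phi>) * \<phi>" 1]]) auto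
  then show ?thesis by (simp add: mult_ac)
qed

theorem theorem4p4:
  fixes f :: "real \<Rightarrow> real"
    and L \<mu> xstar \<alpha> \<beta> \<gamma> K1 K2 \<phi> \<epsilon> :: real
    and lam x c \<eta> :: "nat \<Rightarrow> real"
  assumes "twice_differentiable f"
    and "L > 0" and "\<mu> > 0"
    and "L_smooth L f"
    and "strongly_convex \<mu> f"
    and "is_arg_min f (\<lambda>_. True) xstar"
    and "0 < \<alpha>" and "\<alpha> < 1"
    and "\<gamma> = (1 - \<alpha>) / (2 - \<alpha>)"
    and "K1 = (L + \<mu>) / 2 * (\<beta> - \<gamma>)"
    and "K2 = (if \<beta> \<ge> 0 then (L - \<mu>) / 2 * (\<beta> + \<gamma>) else (\<mu> - L) / 2 * (\<beta> - \<gamma>))"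
    and "0 < \<phi>" and "\<phi> < 2" and "\<epsilon> > 0"
    and "\<forall>t. 1 - K1 * lam t - K2 * \<bar>lam t\<bar> > \<epsilon>"
    and "\<forall>t. x t - c t = - lam t * deriv f (x t)"
    and "\<forall>t. \<eta> t = (1 - K1 * lam t - K2 * \<bar>lam t\<bar>) * \<phi>
                    / ((1 - K1 * lam t + K2 * \<bar>lam t\<bar>)\<^sup>2 * L)"
    and "\<forall>t. x (Suc t) = x t - \<eta> t * caputo_delta \<alpha> \<beta> (c t) f (x t)"
  shows "\<forall>t. \<bar>x (Suc t) - xstar\<bar>\<^sup>2
               \<le> (1 - (2 - \<phi>) * \<phi> * (\<mu> / L) *
                      ((1 - K1 * lam t - K2 * \<bar>lam t\<bar>) / (1 - K1 * lam t + K2 * \<bar>lam t\<bar>))\<^sup>2)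
                  * \<bar>x t - xstar\<bar>\<^sup>2
           \<and> 1 - \<mu> / L
               \<le> 1 - (2 - \<phi>) * \<phi> * (\<mu> / L) *
                      ((1 - K1 * lam t - K2 * \<bar>lam t\<bar>) / (1 - K1 * lam t + K2 * \<bar>lam t\<bar>))\<^sup>2"
proof -
  note f_twice = assms(1) and L_pos = assms(2) and \<mu>_pos = assms(3)
    and smooth = assms(4) and convex = assms(5) and min = assms(6)
    and \<alpha> = assms(7,8) and \<gamma> = assms(9) and K1 = assms(10) and K2 = assms(11)
    and \<phi> = assms(12,13) and eps = assms(14) and lam = assms(15) and c = assms(16)
    and eta = assms(17) and step = assms(18)
  note lower = deriv_increment_lower[OF convex] and upper = deriv_increment_upper[OF smooth]
  have der1: "(f has_real_derivative deriv f y) (at y)"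
    and der2: "(deriv f has_real_derivative deriv (deriv f) y) (at y)" for y
    using f_twice
    by (auto simp: twice_differentiable_def DERIV_deriv_iff_real_differentiable)
  have range: "deriv (deriv f) y \<in> {\<mu>..L}" for y
    by (rule derivative_bounds_from_increments[OF der2 lower upper])
  have \<mu>_le_L: "\<mu> \<le> L" using range[of 0] by simp
  have \<gamma>_pos: "0 < \<gamma>" using \<alpha> \<gamma> by simp
  \<comment> \<open>The two cases of the definition of \<open>K2\<close> are the two values of \<open>\<bar>\<beta>\<bar>\<close>.\<close>
  have K2_eq: "K2 = (L - \<mu>) / 2 * (\<bar>\<beta>\<bar> + \<gamma>)"
    unfolding K2 by (auto simp: field_simps)
  have K2_nonneg: "0 \<le> K2"
    unfolding K2_eq using \<mu>_le_L \<gamma>_pos by simp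
  have deriv_min: "deriv f xstar = 0"
    using min by (intro DERIV_local_min[OF der1, of 1]) (auto simp: is_arg_min_def not_less)
  show ?thesis
  proof (intro allI)
    fix t
    define l where "l = lam t"
    define A where "A = 1 - K1 * l - K2 * \<bar>l\<bar>"
    define B where "B = 1 - K1 * l + K2 * \<bar>l\<bar>"
    define g where "g = deriv f (x t)"
    define d where "d = x t - xstar"
    define \<delta> where "\<delta> = caputo_delta \<alpha> \<beta> (c t) f (x t)"
    have A_pos: "0 < A"
      using lam eps unfolding A_def l_def by (meson less_trans)
    have A_le_B: "A \<le> B"
      using K2_nonneg unfolding A_def B_def by simp
    have displ: "x t - c t = - l * g"
      using c by (simp add: l_def g_def)
    \<comment> \<open>The deviation is proportional to \<open>x t - c t\<close>, hence to \<open>g\<close>: this is the reason for choosing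
      \<open>c t\<close> by the derivative.\<close>
    have "\<bar>\<delta> - g - K1 * (x t - c t)\<bar> \<le> K2 * \<bar>x t - c t\<bar>"
      unfolding \<delta>_def g_def K1 K2_eq by (rule caputo_delta_deviation[OF der2 range \<alpha> \<gamma>])
    then have dev: "\<bar>\<delta> - (1 - K1 * l) * g\<bar> \<le> K2 * \<bar>l\<bar> * \<bar>g\<bar>"
      unfolding displ by (simp add: abs_mult algebra_simps)
    obtain m where m: "A \<le> m" "m \<le> B" and \<delta>_eq: "\<delta> = m * g"
    proof (cases "g = 0")
      case True
      then show ?thesis using dev A_le_B that[of A] by simp
    next
      case False
      have "\<bar>\<delta> / g - (1 - K1 * l)\<bar> * \<bar>g\<bar> = \<bar>\<delta> - (1 - K1 * l) * g\<bar>"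
        unfolding abs_mult[symmetric] using False by (simp add: algebra_simps)
      then have "\<bar>\<delta> / g - (1 - K1 * l)\<bar> * \<bar>g\<bar> \<le> K2 * \<bar>l\<bar> * \<bar>g\<bar>"
        using dev by (simp only:)
      then have "\<bar>\<delta> / g - (1 - K1 * l)\<bar> \<le> K2 * \<bar>l\<bar>"
        by (rule mult_right_le_imp_le) (use False in simp)
      then show ?thesis
        using that[of "\<delta> / g"] False unfolding A_def B_def abs_le_iff by simp
    qed
    obtain h where h: "\<mu> \<le> h" "h \<le> L" and g_eq: "g = h * d"
    proof (cases "d = 0")
      case True
      then show ?thesis using that[of \<mu>] \<mu>_le_L deriv_min by (simp add: g_def d_def)
    next
      case False
      have "\<mu> * d\<^sup>2 \<le> g / d * d\<^sup>2" "g / d * d\<^sup>2 \<le> L * d\<^sup>2"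
        using lower[where x=xstar and y="x t"] upper[where x=xstar and y="x t"] deriv_min False
        by (simp_all add: g_def d_def power2_eq_square)
      then have "\<mu> \<le> g / d" "g / d \<le> L"
        using False by (auto elim!: mult_right_le_imp_le simp del: times_divide_eq_left)
      then show ?thesis
        using that[of "g / d"] False by simp
    qed
    have "x (Suc t) - xstar = d - A * \<phi> / (B\<^sup>2 * L) * (m * (h * d))"
      using step eta unfolding g_eq[symmetric] \<delta>_eq[symmetric]
      by (simp add: A_def B_def l_def d_def \<delta>_def)
    then have "\<bar>x (Suc t) - xstar\<bar>\<^sup>2
        \<le> (1 - (2 - \<phi>) * \<phi> * (\<mu> / L) * (A / B)\<^sup>2) * \<bar>x t - xstar\<bar>\<^sup>2"
      using scaled_gradient_step_contracts[OF A_pos \<mu>_pos \<phi> m h, of d]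
      by (simp only: power2_abs flip: d_def)
    moreover have "1 - \<mu> / L \<le> 1 - (2 - \<phi>) * \<phi> * (\<mu> / L) * (A / B)\<^sup>2"
      by (rule contraction_factor_ge_gradient_descent[OF A_pos A_le_B \<mu>_pos L_pos])
    ultimately show "\<bar>x (Suc t) - xstar\<bar>\<^sup>2
        \<le> (1 - (2 - \<phi>) * \<phi> * (\<mu> / L) *
            ((1 - K1 * lam t - K2 * \<bar>lam t\<bar>) / (1 - K1 * lam t + K2 * \<bar>lam t\<bar>))\<^sup>2) * \<bar>x t - xstar\<bar>\<^sup>2
      \<and> 1 - \<mu> / L \<le> 1 - (2 - \<phi>) * \<phi> * (\<mu> / L) *
            ((1 - K1 * lam t - K2 * \<bar>lam t\<bar>) / (1 - K1 * lam t + K2 * \<bar>lam t\<bar>))\<^sup>2"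
      unfolding A_def B_def l_def by blast
  qed
qed

end
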